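(* Let $Q=(q_{ij})_{1\le i,j\le N}$ be an irreducible transition rate matrix with steady-state distribution $\mu=(\mu_1,\dots,\mu_N)$, let $p(0)$ be any probability distribution on $\{1,\dots,N\}$, and let $p(t)=(p_1(t),\dots,p_N(t))$ be the solution of the master equation $\frac{dp}{dt}=pQ$ with initial value $p(0)$. Then for every $t\ge 0$, writing $p_i=p_i(t)$, the free energy $F=\sum_i p_i\log\frac{p_i}{\mu_i}$ satisfies $$F \;\ge\; \frac12\sum_i (p_i-\mu_i)^2 .$$
   Context: Transition rate matrix on the finite state space $\{1,\dots,N\}$: a real matrix $Q=(q_{ij})$ with $q_{ij}\ge 0$ for $i\ne j$ and $q_{ii}=-\sum_{j\ne i}q_{ij}$. Irreducible: for each pair of states $i\neq j$ there is a sequence of states $i_1=i,i_2,\dots,i_m=j$ with $q_{i_1i_2}q_{i_2i_3}\cdots q_{i_{m-1}i_m}>0$. Under irreducibility there is a unique probability distribution $\mu$ with $\mu Q=0$ (the steady-state distribution), and all its components are positive. For any initial probability distribution $p(0)$, the solution $p(t)$ (a row vector) of $dp/dt=pQ$ is a probability distribution for all $t\ge 0$, and all its components are positive for $t>0$. Convention: $0\log 0=0$. *)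

theory Defs
  imports "HOL-Analysis.Analysis"
begin

text \<open>
  The state space is a finite type, so the number of states is \<open>CARD('n)\<close>.  Distributions are row
  vectors, and \<open>Q $ i $ j\<close> is the rate of the transition from \<open>i\<close> to \<open>j\<close>.
\<close>

definition prob_dist :: "real ^ 'n::finite \<Rightarrow> bool" where
  "prob_dist p \<longleftrightarrow> (\<forall>i. p $ i \<ge> 0) \<and> (\<Sum>i\<in>UNIV. p $ i) = 1"

definition rate_matrix :: "real ^ 'n::finite ^ 'n \<Rightarrow> bool" where
  "rate_matrix Q \<longleftrightarrow>
     (\<forall>i j. i \<noteq> j \<longrightarrow> Q $ i $ j \<ge> 0) \<and>
     (\<forall>i. Q $ i $ i = - (\<Sum>j\<in>UNIV - {i}. Q $ i $ j))"

definition irreducible_rates :: "real ^ 'n::finite ^ 'n \<Rightarrow> bool" where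
  "irreducible_rates Q \<longleftrightarrow>
     (\<forall>i j. i \<noteq> j \<longrightarrow>
        (\<exists>xs. xs \<noteq> [] \<and> hd xs = i \<and> last xs = j \<and>
              (\<Prod>k<length xs - 1. Q $ (xs ! k) $ (xs ! Suc k)) > 0))"

definition steady_state :: "real ^ 'n::finite ^ 'n \<Rightarrow> real ^ 'n \<Rightarrow> bool" where
  "steady_state Q \<mu> \<longleftrightarrow> prob_dist \<mu> \<and> \<mu> v* Q = 0"

text \<open>Only times \<open>t \<ge> 0\<close> are constrained; the derivative at \<open>0\<close> is one-sided.\<close>

definition solves_master_equation ::
    "real ^ 'n::finite ^ 'n \<Rightarrow> (real \<Rightarrow> real ^ 'n) \<Rightarrow> bool" where
  "solves_master_equation Q p \<longleftrightarrow>
     (\<forall>t\<ge>0. (p has_vector_derivative (p t v* Q)) (at t within {0..}))"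

text \<open>Natural logarithm; the convention \<open>0 log 0 = 0\<close> holds because of the factor \<open>p $ i\<close>.\<close>

definition free_energy :: "real ^ 'n::finite \<Rightarrow> real ^ 'n \<Rightarrow> real" where
  "free_energy \<mu> p = (\<Sum>i\<in>UNIV. p $ i * ln (p $ i / \<mu> $ i))"

end

theory Submission
  imports Defs
begin

text \<open>
  Both distributions have components in \<open>[0, 1]\<close>, and there \<open>x ln x\<close> has second derivative
  \<open>1 / x \<ge> 1\<close>.  The estimate is the second-order Taylor bound for \<open>x ln x\<close> at \<open>\<mu>\<^sub>i\<close>, summed over \<open>i\<close>;
  the linear terms cancel because both distributions have total mass \<open>1\<close>.  The flow preserves
  nonnegativity because \<open>\<Sum>\<^sub>i (min p\<^sub>i 0)\<^sup>2\<close> satisfies a Gronwall inequality and vanishes at time \<open>0\<close>.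
\<close>

lemma x_ln_ratio_ge:
  fixes x m :: real
  assumes "0 \<le> x" "x \<le> 1" "0 < m" "m \<le> 1"
  shows "x * ln (x / m) \<ge> x - m + (x - m)\<^sup>2 / 2"
proof (cases "x = 0")
  case True
  \<comment> \<open>At \<open>x = 0\<close> the convention makes the left side \<open>0\<close>, and
    the claim becomes m^2 / 2 \<le> m.\<close>
  have "m * m \<le> m * 2" using assms by (intro mult_left_mono) auto
  then show ?thesis using True by (simp add: power2_eq_square)
next
  case False
  then have "x > 0" using assms by simp
  \<comment> \<open>Tangent at \<open>m\<close> to x ln x - x^2 / 2, which is convex on
    \<open>{0<..1}\<close> because its second derivative 1/x - 1 is nonnegative there. The interval
    excludes \<open>0\<close>, hence the separate case above.\<close>
  have "(ln m + 1 - m) * (x - m) \<le> (x * ln x - x\<^sup>2 / 2) - (m * ln m - m\<^sup>2 / 2)"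
  proof (rule f''_imp_f'[where C = "{0<..1::real}" and f = "\<lambda>x. x * ln x - x\<^sup>2 / 2"
          and f' = "\<lambda>x. ln x + 1 - x" and f'' = "\<lambda>x. 1 / x - 1"])
    show "x \<in> {0<..1}" "m \<in> {0<..1}" using assms \<open>x > 0\<close> by auto
  qed (auto intro!: derivative_eq_intros simp: field_simps)
  then show ?thesis
    using \<open>x > 0\<close> assms by (simp add: ln_div power2_eq_square field_simps)
qed

lemma prob_dist_le_1: "prob_dist p \<Longrightarrow> p $ i \<le> 1"
  unfolding prob_dist_def by (metis UNIV_I finite member_le_sum)

lemma free_energy_ge:
  assumes p: "prob_dist p" and m: "prob_dist \<mu>" and pos: "\<And>i. \<mu> $ i > 0"
  shows "free_energy \<mu> p \<ge> 1 / 2 * (\<Sum>i\<in>UNIV. (p $ i - \<mu> $ i)\<^sup>2)"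
proof -
  have "(\<Sum>i\<in>UNIV. p $ i - \<mu> $ i + (p $ i - \<mu> $ i)\<^sup>2 / 2) \<le> free_energy \<mu> p"
    unfolding free_energy_def using p m pos prob_dist_le_1
    by (intro sum_mono x_ln_ratio_ge) (auto simp: prob_dist_def)
  moreover have "(\<Sum>i\<in>UNIV. p $ i - \<mu> $ i) = 0"
    using p m by (simp add: prob_dist_def sum_subtractf)
  ultimately show ?thesis
    by (simp add: sum.distrib sum_divide_distrib)
qed

text \<open>Zeros of \<open>\<mu>\<close> spread backwards along transitions: if \<mu>_k = 0,
  stationarity makes the inflow into k a vanishing sum of nonnegative terms, so every state feeding
  k also has mass 0. By irreducibility a single zero reaches all states, which contradicts total
  mass 1.\<close>

lemma steady_state_pos:
  assumes Q: "rate_matrix Q" and irr: "irreducible_rates Q" and st: "steady_state Q \<mu>"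
  shows "\<mu> $ j > 0"
proof (rule ccontr)
  have nonneg: "\<mu> $ i \<ge> 0" for i using st by (simp add: steady_state_def prob_dist_def)
  \<comment> \<open>A path may repeat a state and so contain a diagonal, nonpositive rate. Hence the
    rate is only assumed nonzero and \<open>i = k\<close> is allowed.\<close>
  have step: "\<mu> $ i = 0" if k: "\<mu> $ k = 0" and q: "Q $ i $ k \<noteq> 0" for i k
  proof (cases "i = k")
    case False
    have "(\<Sum>l\<in>UNIV. \<mu> $ l * Q $ l $ k) = 0"
      using st by (simp add: steady_state_def vec_eq_iff vector_matrix_mult_def mult.commute)
    moreover have "\<mu> $ l * Q $ l $ k \<ge> 0" for l
      using nonneg Q k by (cases "l = k") (auto simp: rate_matrix_def)
    ultimately have "\<mu> $ i * Q $ i $ k = 0"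
      by (simp add: sum_nonneg_eq_0_iff)
    with q show ?thesis by simp
  qed (use k in simp)
  assume "\<not> \<mu> $ j > 0"
  with nonneg have j: "\<mu> $ j = 0" by (metis less_eq_real_def)
  have "\<mu> $ i = 0" for i
  proof (cases "i = j")
    case False
    then obtain xs where xs: "xs \<noteq> []" "hd xs = i" "last xs = j"
      "(\<Prod>k<length xs - 1. Q $ (xs ! k) $ (xs ! Suc k)) > 0"
      using irr unfolding irreducible_rates_def by blast
    have edge: "Q $ (xs ! k) $ (xs ! Suc k) \<noteq> 0" if "k < length xs - 1" for k
      using xs(4) that by (metis (no_types, lifting) finite_lessThan lessThan_iff less_irrefl prod_zero)
    have "\<mu> $ (xs ! 0) = 0"
      \<comment> \<open>Downward induction on the position in the path, from its last state
        \<open>j\<close> to its first state \<open>i\<close>.\<close>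
      by (rule inc_induct[of 0 "length xs - 1"])
        (use xs j step edge in \<open>auto simp: last_conv_nth\<close>)
    then show ?thesis using xs by (simp add: hd_conv_nth)
  qed (use j in simp)
  then show False using st by (simp add: steady_state_def prob_dist_def)
qed

lemma solution_component:
  assumes "solves_master_equation Q p" and "t \<ge> 0"
  shows "((\<lambda>t. p t $ j) has_real_derivative (\<Sum>i\<in>UNIV. p t $ i * Q $ i $ j)) (at t within {0..})"
proof -
  have "((\<lambda>t. p t $ j) has_vector_derivative (p t v* Q) $ j) (at t within {0..})"
    using assms bounded_linear.has_vector_derivative[OF bounded_linear_vec_nth]
    unfolding solves_master_equation_def by blast
  then show ?thesis
    by (simp add: has_real_derivative_iff_has_vector_derivative vector_matrix_mult_def mult.commute)
qed

lemma rate_matrix_row_sum: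
  assumes "rate_matrix Q"
  shows "(\<Sum>j\<in>UNIV. Q $ i $ j) = 0"
proof -
  have "(\<Sum>j\<in>UNIV. Q $ i $ j) = Q $ i $ i + (\<Sum>j\<in>UNIV - {i}. Q $ i $ j)"
    by (rule sum.remove) auto
  then show ?thesis using assms by (simp add: rate_matrix_def)
qed

lemma solution_mass_constant:
  assumes Q: "rate_matrix Q" and sol: "solves_master_equation Q p" and t: "t \<ge> 0"
  shows "(\<Sum>i\<in>UNIV. p t $ i) = (\<Sum>i\<in>UNIV. p 0 $ i)"
proof -
  have "((\<lambda>t. \<Sum>j\<in>UNIV. p t $ j) has_real_derivative 0) (at s within {0..})" if "s \<in> {0..}" for s
  proof -
    \<comment> \<open>The derivative of the total mass, regrouped so that each p_i multiplies a row
      sum of \<open>Q\<close>, which is zero.\<close>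
    have "(\<Sum>j\<in>UNIV. \<Sum>i\<in>UNIV. p s $ i * Q $ i $ j) = (\<Sum>i\<in>UNIV. \<Sum>j\<in>UNIV. p s $ i * Q $ i $ j)"
      by (rule sum.swap)
    also have "\<dots> = 0"
      by (simp add: sum_distrib_left[symmetric] rate_matrix_row_sum[OF Q])
    finally show ?thesis
      using DERIV_sum[of UNIV "\<lambda>t j. p t $ j" "\<lambda>j. \<Sum>i\<in>UNIV. p s $ i * Q $ i $ j"]
        solution_component[OF sol] that by fastforce
  qed
  then have "\<exists>c. \<forall>s\<in>{0..}. (\<Sum>j\<in>UNIV. p s $ j) = c"
    by (intro has_field_derivative_zero_constant) auto
  then show ?thesis using t by auto
qed

text \<open>Squaring removes the kink of \<open>min x 0\<close>: at 0 the difference quotient is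
  bounded by |h|. This makes the squared negative part usable in a differential inequality.\<close>

lemma DERIV_min_0_square:
  "((\<lambda>x::real. (min x 0)\<^sup>2) has_real_derivative 2 * min x 0) (at x)"
proof (cases x "0::real" rule: linorder_cases)
  case less
  have "((\<lambda>x::real. x\<^sup>2) has_real_derivative 2 * min x 0) (at x)"
    using less by (auto intro!: derivative_eq_intros)
  then show ?thesis
    by (rule has_field_derivative_transform_within_open[where S = "{..<0}"]) (use less in auto)
next
  case equal
  have "((\<lambda>h::real. (min h 0)\<^sup>2 / h) \<longlongrightarrow> 0) (at 0)"
    by (rule Lim_null_comparison[where g = abs])
      (auto intro!: tendsto_eq_intros always_eventually simp: min_def power2_eq_square)
  then show ?thesis using equal by (simp add: DERIV_def)
next
  case greater
  have "((\<lambda>x::real. 0) has_real_derivative 2 * min x 0) (at x)"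
    using greater by simp
  then show ?thesis
    by (rule has_field_derivative_transform_within_open[where S = "{0<..}"]) (use greater in auto)
qed

lemma Gronwall_nonpos:
  fixes V V' :: "real \<Rightarrow> real"
  assumes der: "\<And>s. s \<ge> 0 \<Longrightarrow> (V has_real_derivative V' s) (at s within {0..})"
    and le: "\<And>s. s \<ge> 0 \<Longrightarrow> V' s \<le> C * V s"
    and V0: "V 0 \<le> 0" and t: "t \<ge> 0"
  shows "V t \<le> 0"
proof -
  \<comment> \<open>Integrating factor: the hypothesis on \<open>V'\<close> says exactly that the
    derivative of \<open>?W\<close> is nonpositive.\<close>
  let ?W = "\<lambda>s. exp (- C * s) * V s"
  have W: "(?W has_real_derivative exp (- C * s) * (V' s - C * V s)) (at s within {0..t})"
    if "0 \<le> s" for s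
    using DERIV_subset[OF der[OF that], of "{0..t}"]
    by (auto intro!: derivative_eq_intros simp: algebra_simps)
  have "?W t \<le> ?W 0"
  proof (rule DERIV_nonpos_imp_decreasing_open[OF t])
    fix s assume s: "0 < s" "s < t"
    then have "(?W has_real_derivative exp (- C * s) * (V' s - C * V s)) (at s)"
      using W[of s] at_within_Icc_at[of 0 s t] by simp
    then show "\<exists>y. (?W has_real_derivative y) (at s) \<and> y \<le> 0"
      using le[of s] s by (intro exI conjI) (auto simp: mult_nonneg_nonpos)
  next
    show "continuous_on {0..t} ?W"
      using W by (intro DERIV_continuous_on[where D = "\<lambda>s. exp (- C * s) * (V' s - C * V s)"]) auto
  qed
  with V0 have "exp (- C * t) * V t \<le> 0" by simp
  then show ?thesis by (simp add: mult_le_0_iff)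
qed

lemma solution_nonneg:
  fixes Q :: "real ^ 'n::finite ^ 'n"
  assumes Q: "rate_matrix Q" and sol: "solves_master_equation Q p"
    and p0: "\<And>i. p 0 $ i \<ge> 0" and t: "t \<ge> 0"
  shows "p t $ k \<ge> 0"
proof -
  define m where "m s j = min (p s $ j) 0" for s j
  define V where "V s = (\<Sum>j\<in>UNIV. (m s j)\<^sup>2)" for s
  define V' where "V' s = (\<Sum>j\<in>UNIV. 2 * m s j * (\<Sum>i\<in>UNIV. p s $ i * Q $ i $ j))" for s
  \<comment> \<open>The factor 2 comes from differentiating the squares; the sum collects the bounds
    \<open>entry\<close> over all pairs.\<close>
  define C where "C = 2 * (\<Sum>j\<in>UNIV. \<Sum>i\<in>UNIV. \<bar>Q $ i $ j\<bar>)"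
  have "V t \<le> 0"
  proof (rule Gronwall_nonpos[OF _ _ _ t])
    fix s :: real assume s: "s \<ge> 0"
    show "(V has_real_derivative V' s) (at s within {0..})"
      unfolding V_def V'_def m_def
      by (intro DERIV_sum DERIV_chain2[OF DERIV_min_0_square] solution_component[OF sol s])
    have entry: "m s j * (p s $ i * Q $ i $ j) \<le> \<bar>Q $ i $ j\<bar> * V s" for i j
    proof -
      \<comment> \<open>Replaces p_i by its negative part. On the diagonal this is an equality,
        since m_j p_j = m_j^2. Off the diagonal m_j Q_ij \<le> 0 and p_i \<ge> m_i, so the sign
        condition on the rates enters here.\<close>
      have "m s j * (p s $ i * Q $ i $ j) \<le> m s i * m s j * Q $ i $ j"
      proof (cases "i = j")
        case True
        then show ?thesis by (auto simp: m_def min_def)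
      next
        case False
        then have "m s j * Q $ i $ j \<le> 0"
          using Q by (auto simp: rate_matrix_def m_def intro!: mult_nonpos_nonneg)
        then have "(m s j * Q $ i $ j) * p s $ i \<le> (m s j * Q $ i $ j) * m s i"
          by (intro mult_left_mono_neg) (auto simp: m_def)
        then show ?thesis by (simp add: ac_simps)
      qed
      also have "\<dots> \<le> \<bar>m s i * m s j\<bar> * \<bar>Q $ i $ j\<bar>"
        by (metis abs_ge_self abs_mult)
      also have "\<dots> \<le> V s * \<bar>Q $ i $ j\<bar>"
      proof (intro mult_right_mono)
        \<comment> \<open>Each square is at most V, so 2 |m_i m_j| \<le> m_i^2 + m_j^2 \<le> 2 V,
          also when i = j.\<close>
        have "(m s l)\<^sup>2 \<le> V s" for l
          unfolding V_def by (rule member_le_sum) auto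
        from this[of i] this[of j] show "\<bar>m s i * m s j\<bar> \<le> V s"
          using sum_squares_bound[of "\<bar>m s i\<bar>" "\<bar>m s j\<bar>"] by (simp add: abs_mult)
      qed simp
      finally show ?thesis by (simp add: mult.commute)
    qed
    have "V' s = 2 * (\<Sum>j\<in>UNIV. \<Sum>i\<in>UNIV. m s j * (p s $ i * Q $ i $ j))"
      by (simp add: V'_def sum_distrib_left mult.assoc)
    also have "\<dots> \<le> 2 * (\<Sum>j\<in>UNIV. \<Sum>i\<in>UNIV. \<bar>Q $ i $ j\<bar> * V s)"
      using entry by (intro mult_left_mono sum_mono) auto
    also have "\<dots> = C * V s"
      by (simp add: C_def sum_distrib_right)
    finally show "V' s \<le> C * V s" .
  next
    show "V 0 \<le> 0" using p0 by (simp add: V_def m_def)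
  qed
  moreover have "(m t k)\<^sup>2 \<le> V t"
    unfolding V_def by (rule member_le_sum) auto
  ultimately have "(m t k)\<^sup>2 \<le> 0" by linarith
  then show ?thesis by (simp add: m_def min_def split: if_splits)
qed

theorem theorem3p2:
  fixes Q :: "real ^ 'n::finite ^ 'n"
    and \<mu> :: "real ^ 'n"
    and p :: "real \<Rightarrow> real ^ 'n"
    and t :: real
  assumes "rate_matrix Q"
    and "irreducible_rates Q"
    and "steady_state Q \<mu>"
    and "prob_dist (p 0)"
    and "solves_master_equation Q p"
    and "t \<ge> 0"
  shows "free_energy \<mu> (p t) \<ge> 1 / 2 * (\<Sum>i\<in>UNIV. (p t $ i - \<mu> $ i)\<^sup>2)"
proof (rule free_energy_ge)
  show "prob_dist (p t)"
    using assms solution_nonneg[of Q p t] solution_mass_constant[of Q p t]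
    by (simp add: prob_dist_def)
  show "prob_dist \<mu>" using assms(3) by (simp add: steady_state_def)
  show "\<mu> $ i > 0" for i using assms by (intro steady_state_pos)
qed

end
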